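(* We have $\mathcal N=\{n\in\mathbb N: n^2-4\in\mathcal S\}$, and for $n\in\mathcal N$ we have $$\{\theta(\gamma):\gamma\in\Gamma^n\}=\{\arg(x+iy): x,y\in\mathbb Z,\ x\equiv0\pmod 2,\ x^2+y^2=n^2-4\}.$$
   Context: Let $\mathcal S=\{x^2+y^2:x,y\in\mathbb Z\}$ be the set of integers that are sums of two integer squares. Let $\Gamma=\mathrm{PSL}_2(\mathbb Z)=\mathrm{SL}_2(\mathbb Z)/\{\pm I\}$ act on the upper half plane $\mathbb H$ by Möbius transformations $\gamma(z)=\frac{az+b}{cz+d}$ for $\gamma=\begin{pmatrix}a&b\\c&d\end{pmatrix}$, and put $\|\gamma\|^2=a^2+b^2+c^2+d^2$. For $n\in\mathbb N$ let $\Gamma^n=\{\gamma\in\Gamma:\|\gamma\|^2=n\}$, and let $\mathcal N=\{n\in\mathbb N:|\Gamma^n|>0\}$. Let $f(z)=\frac{z-i}{1-iz}$, which maps $\mathbb H$ conformally onto the unit disc with $f(i)=0$, and for $\gamma\in\Gamma^n$ let $\theta(\gamma)=\arg f(\gamma(i))$ (complex argument). *)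

theory Defs
  imports "HOL-Analysis.Analysis" "HOL-Algebra.Coset" "HOL-Number_Theory.Cong"
begin

definition sums_two_squares :: "int set" where
  "sums_two_squares = {x\<^sup>2 + y\<^sup>2 | x y. True}"

definition SL2Z :: "(int^2^2) monoid" where
  "SL2Z = \<lparr>carrier = {A. det A = 1}, mult = (**), one = mat 1\<rparr>"

text \<open>Elements of the quotient are the cosets \<open>{A, -A}\<close>, see \<open>PSL2Z_coset\<close> below.\<close>

definition PSL2Z :: "(int^2^2) set monoid" where
  "PSL2Z = SL2Z Mod {mat 1, - mat 1}"

definition mat_normsq :: "int^2^2 \<Rightarrow> int" where
  "mat_normsq A = (A$1$1)\<^sup>2 + (A$1$2)\<^sup>2 + (A$2$1)\<^sup>2 + (A$2$2)\<^sup>2"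

definition mat_moebius :: "int^2^2 \<Rightarrow> complex \<Rightarrow> complex" where
  "mat_moebius A z =
     (of_int (A$1$1) * z + of_int (A$1$2)) / (of_int (A$2$1) * z + of_int (A$2$2))"

text \<open>
  On a coset, the norm and the Moebius transformation are the common value of the
  respective matrix function on its representatives; \<open>PSL2Z_normsq\<close> and
  \<open>PSL2Z_moebius\<close> show that this is well defined.
\<close>

definition normsq :: "(int^2^2) set \<Rightarrow> int" where
  "normsq \<gamma> = the_elem (mat_normsq ` \<gamma>)"

definition moebius :: "(int^2^2) set \<Rightarrow> complex \<Rightarrow> complex" where
  "moebius \<gamma> = the_elem (mat_moebius ` \<gamma>)"

definition Gamma_norm :: "nat \<Rightarrow> (int^2^2) set set" where
  "Gamma_norm n = {\<gamma> \<in> carrier PSL2Z. normsq \<gamma> = int n}"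

definition norm_set :: "nat set" where
  "norm_set = {n. card (Gamma_norm n) > 0}"

definition to_disc :: "complex \<Rightarrow> complex" where
  "to_disc z = (z - \<i>) / (1 - \<i> * z)"

text \<open>
  The argument is the principal one, in \<open>(-pi, pi]\<close>. For \<open>\<gamma>\<close> fixing \<open>\<i>\<close> (i.e. norm squared 2)
  it is taken at 0, where the library convention is \<open>Arg 0 = 0\<close>.
\<close>

definition theta :: "(int^2^2) set \<Rightarrow> real" where
  "theta \<gamma> = Arg (to_disc (moebius \<gamma> \<i>))"

lemma matrix_uminus_left: "(- A) ** B = - (A ** B)" for A B :: "int^2^2"
  by (simp add: vec_eq_iff matrix_matrix_mult_def sum_negf)

lemma matrix_uminus_right: "A ** (- B) = - (A ** B)" for A B :: "int^2^2"
  by (simp add: vec_eq_iff matrix_matrix_mult_def sum_negf)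

lemma det_uminus: "det (- A) = det A" for A :: "int^2^2"
  by (simp add: det_2)

lemma group_SL2Z: "group SL2Z"
proof (rule groupI)
  fix A assume "A \<in> carrier SL2Z"
  then have d: "A$1$1 * A$2$2 - A$1$2 * A$2$1 = 1" by (simp add: SL2Z_def det_2)
  define B :: "int^2^2" where "B = vector [vector [A$2$2, - A$1$2], vector [- A$2$1, A$1$1]]"
  have "det B = 1" using d by (simp add: B_def det_2 algebra_simps)
  moreover have "B ** A = mat 1"
    using d by (simp add: B_def vec_eq_iff matrix_matrix_mult_def mat_def forall_2 sum_2 algebra_simps)
  ultimately show "\<exists>B\<in>carrier SL2Z. B \<otimes>\<^bsub>SL2Z\<^esub> A = \<one>\<^bsub>SL2Z\<^esub>"
    by (auto simp: SL2Z_def)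
qed (auto simp: SL2Z_def det_mul matrix_mul_assoc)

lemma subgroup_pm1: "subgroup {mat 1, - mat 1} SL2Z"
proof (rule group.subgroupI [OF group_SL2Z])
  show "{mat 1, - mat 1} \<subseteq> carrier SL2Z" by (auto simp: SL2Z_def det_uminus)
next
  fix A :: "int^2^2" assume A: "A \<in> {mat 1, - mat 1}"
  have "inv\<^bsub>SL2Z\<^esub> A = A"
    by (rule group.inv_equality [OF group_SL2Z])
       (use A in \<open>auto simp: SL2Z_def det_uminus matrix_uminus_left matrix_uminus_right\<close>)
  then show "inv\<^bsub>SL2Z\<^esub> A \<in> {mat 1, - mat 1}" using A by simp
qed (auto simp: SL2Z_def matrix_uminus_left matrix_uminus_right)

lemma SL2Z_r_coset: "{mat 1, - mat 1} #>\<^bsub>SL2Z\<^esub> A = {A, - A}"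
  by (auto simp: r_coset_def SL2Z_def matrix_uminus_left)

lemma normal_pm1: "{mat 1, - mat 1} \<lhd> SL2Z"
proof -
  have "A <#\<^bsub>SL2Z\<^esub> {mat 1, - mat 1} = {A, - A}" for A
    by (auto simp: l_coset_def SL2Z_def matrix_uminus_right)
  then show ?thesis
    by (simp add: normal_def normal_axioms_def group_SL2Z subgroup_pm1 SL2Z_r_coset)
qed

lemma group_PSL2Z: "group PSL2Z"
  unfolding PSL2Z_def by (rule normal.factorgroup_is_group [OF normal_pm1])

lemma PSL2Z_coset: "carrier PSL2Z = {{A, - A} | A. det A = 1}"
  by (auto simp: PSL2Z_def FactGroup_def RCOSETS_def SL2Z_r_coset) (auto simp: SL2Z_def)

lemma mat_normsq_uminus: "mat_normsq (- A) = mat_normsq A"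
  by (simp add: mat_normsq_def)

lemma mat_moebius_uminus: "mat_moebius (- A) = mat_moebius A"
proof
  fix z
  have "(- (a * z) - b) / (- (c * z) - d) = (a * z + b) / (c * z + d)" for a b c d :: complex
  proof -
    have "- (a * z) - b = - (a * z + b)" "- (c * z) - d = - (c * z + d)" by simp_all
    then show ?thesis by (simp only: minus_divide_divide)
  qed
  then show "mat_moebius (- A) z = mat_moebius A z"
    by (simp add: mat_moebius_def)
qed

lemma PSL2Z_normsq: "normsq {A, - A} = mat_normsq A"
  by (simp add: normsq_def mat_normsq_uminus)

lemma PSL2Z_moebius: "moebius {A, - A} = mat_moebius A"
  by (simp add: moebius_def mat_moebius_uminus)

end

theory Submission imports Defs begin

text \<open>
  Let \<open>A\<close> have the rows \<open>u = (a, b)\<close> and \<open>v = (c, d)\<close> and determinant 1, and put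
  \<open>p = |u|\<^sup>2\<close>, \<open>q = |v|\<^sup>2\<close>, \<open>k = u \<bullet> v\<close>.  These are the entries of the Gram matrix
  \<open>A A\<^sup>T\<close>, whose determinant is \<open>p q - k\<^sup>2 = 1\<close>, and the squared norm of \<open>A\<close> is \<open>n = p + q\<close>.
  Multiplying out the fraction shows that the image of \<open>\<i>\<close> in the disc is
  \<open>(2 k + \<i> (p - q)) / (n + 2)\<close> (\<open>to_disc_mat_moebius_i\<close>).  So \<open>\<theta>\<close> is the argument of
  \<open>x + \<i> y\<close> with \<open>x = 2 k\<close> even and \<open>y = p - q\<close>, and
  \<open>x\<^sup>2 + y\<^sup>2 = 4 (p q - 1) + (p - q)\<^sup>2 = n\<^sup>2 - 4\<close>.

  Conversely, an even \<open>x\<close> and a \<open>y\<close> with \<open>x\<^sup>2 + y\<^sup>2 = n\<^sup>2 - 4\<close> determine integers \<open>p\<close>, \<open>q\<close>, \<open>k\<close>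
  with \<open>p q = k\<^sup>2 + 1\<close>, and it remains to find a matrix in \<open>SL\<^sub>2(\<int>)\<close> with this Gram matrix.
  That is the fact that every positive definite integral binary quadratic form of determinant 1
  is equivalent to the sum of two squares, proved here by reduction (\<open>gram_matrix_det_one\<close>).

  The description of the set of norms follows, since in a representation of \<open>n\<^sup>2 - 4\<close> as a sum of
  two squares one of the summands is even: two odd squares would give \<open>n\<^sup>2 \<equiv> 2\<close> modulo 4.
\<close>

section \<open>The image of the base point in the disc\<close>

text \<open>
  The common factor \<open>c \<i> + d\<close> cancels between numerator and denominator of \<open>to_disc\<close>, which
  leaves \<open>((b + c) + \<i> (a - d)) / ((a + d) + \<i> (c - b))\<close>.  The squared modulus of this
  denominator is \<open>n + 2\<close> because the determinant is 1.
\<close>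

lemma to_disc_mat_moebius_i:
  assumes "det A = 1"
  shows "to_disc (mat_moebius A \<i>) =
    (of_int (2 * (A$1$1 * A$2$1 + A$1$2 * A$2$2)) +
     \<i> * of_int ((A$1$1)\<^sup>2 + (A$1$2)\<^sup>2 - (A$2$1)\<^sup>2 - (A$2$2)\<^sup>2)) /
    of_int (mat_normsq A + 2)"
proof -
  define a b c d where "a = A$1$1" and "b = A$1$2" and "c = A$2$1" and "d = A$2$2"
  note abcd = this
  have det: "a * d - b * c = 1"
    using assms by (simp add: det_2 abcd)
  define u v :: complex where "u = of_int a * \<i> + of_int b" and "v = of_int c * \<i> + of_int d"
  have "v \<noteq> 0"
  proof
    assume "v = 0"
    then have "c = 0" "d = 0" by (auto simp: v_def complex_eq_iff)
    with det show False by simp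
  qed
  define w where "w = v - \<i> * u"
  define N where "N = a\<^sup>2 + b\<^sup>2 + c\<^sup>2 + d\<^sup>2 + 2"
  have N: "N = (a + d)\<^sup>2 + (c - b)\<^sup>2"
    using det by (simp add: N_def power2_eq_square algebra_simps)
  have "N > 0"
    unfolding N_def by (smt (verit) zero_le_power2)
  have w_cnj: "w * cnj w = of_int N"
    by (simp add: w_def u_def v_def N complex_eq_iff power2_eq_square algebra_simps)
  then have "w \<noteq> 0" using \<open>N > 0\<close> by auto
  have "to_disc (mat_moebius A \<i>) = (u / v - \<i>) / (1 - \<i> * (u / v))"
    by (simp add: to_disc_def mat_moebius_def u_def v_def abcd)
  also have "\<dots> = ((u - \<i> * v) / v) / (w / v)"
    using \<open>v \<noteq> 0\<close> by (simp add: w_def diff_divide_distrib)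
  also have "\<dots> = (u - \<i> * v) / w"
    using \<open>v \<noteq> 0\<close> by simp
  also have "\<dots> = (u - \<i> * v) * cnj w / (w * cnj w)"
    using \<open>w \<noteq> 0\<close> by simp
  also have "(u - \<i> * v) * cnj w =
      of_int (2 * (a * c + b * d)) + \<i> * of_int (a\<^sup>2 + b\<^sup>2 - c\<^sup>2 - d\<^sup>2)"
    by (simp add: w_def u_def v_def complex_eq_iff power2_eq_square algebra_simps)
  finally show ?thesis
    by (simp add: w_cnj N_def mat_normsq_def abcd)
qed

lemma theta_coset:
  assumes "det A = 1"
  shows "theta {A, - A} =
    Arg (of_int (2 * (A$1$1 * A$2$1 + A$1$2 * A$2$2)) +
         \<i> * of_int ((A$1$1)\<^sup>2 + (A$1$2)\<^sup>2 - (A$2$1)\<^sup>2 - (A$2$2)\<^sup>2))"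
proof -
  define z :: complex where "z = of_int (2 * (A$1$1 * A$2$1 + A$1$2 * A$2$2)) +
    \<i> * of_int ((A$1$1)\<^sup>2 + (A$1$2)\<^sup>2 - (A$2$1)\<^sup>2 - (A$2$2)\<^sup>2)"
  have "mat_normsq A + 2 > 0"
    unfolding mat_normsq_def by (smt (verit) zero_le_power2)
  then have pos: "real_of_int (mat_normsq A + 2) > 0"
    by linarith
  have "theta {A, - A} = Arg (z / of_real (real_of_int (mat_normsq A + 2)))"
    using to_disc_mat_moebius_i [OF assms] by (simp add: theta_def PSL2Z_moebius z_def)
  also have "\<dots> = Arg z"
    using pos by (rule Arg_divide_of_real)
  finally show ?thesis
    by (simp only: z_def)
qed

section \<open>Binary quadratic forms of determinant one\<close>

text \<open>
  Reduction of the form with coefficients \<open>p\<close>, \<open>2 k\<close>, \<open>q\<close>.  Unless \<open>k = 0\<close>, where \<open>p = q = 1\<close>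
  and the identity matrix works, the smaller of \<open>p\<close> and \<open>q\<close> is at most \<open>|k|\<close>, because
  \<open>(|k| + 1)\<^sup>2 > k\<^sup>2 + 1\<close>.  If this is \<open>p\<close>, subtracting \<open>\<plusminus>\<close> the first row from the second replaces
  \<open>|k|\<close> by \<open>|k| - p\<close>.  If it is \<open>q\<close>, the roles of the rows are exchanged.
\<close>

lemma gram_matrix_det_one:
  fixes p q k :: int
  assumes "p > 0" "q > 0" "p * q = k\<^sup>2 + 1"
  shows "\<exists>a b c d. a * d - b * c = 1 \<and> a\<^sup>2 + b\<^sup>2 = p \<and> c\<^sup>2 + d\<^sup>2 = q \<and> a * c + b * d = k"
  using assms
proof (induction "nat \<bar>k\<bar>" arbitrary: p q k rule: less_induct)
  case less
  \<comment> \<open>One step of the reduction, stated so that it also serves with the rows exchanged.\<close>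
  have step: "\<exists>a b c d. a * d - b * c = 1 \<and> a\<^sup>2 + b\<^sup>2 = p' \<and> c\<^sup>2 + d\<^sup>2 = q' \<and> a * c + b * d = k"
    if pq: "p' > 0" "q' > 0" "p' * q' = k\<^sup>2 + 1" and le: "p' \<le> \<bar>k\<bar>" for p' q'
  proof -
    define s where "s = sgn k"
    have "k \<noteq> 0" using pq le by auto
    then have s: "s * s = 1" "s * k = \<bar>k\<bar>"
      by (auto simp: s_def sgn_if)
    define k' where "k' = k - s * p'"
    define q1 where "q1 = q' - 2 * s * k + p'"
    have "\<bar>k'\<bar> = \<bar>k\<bar> - p'"
      using le \<open>k \<noteq> 0\<close> by (auto simp: k'_def s_def sgn_if)
    then have dec: "nat \<bar>k'\<bar> < nat \<bar>k\<bar>" using pq le by linarith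
    have "p' * q1 = p' * q' - 2 * p' * (s * k) + (s * s) * p' * p'"
      by (simp add: q1_def s algebra_simps)
    also have "\<dots> = k'\<^sup>2 + 1"
      using pq(3) by (simp add: k'_def power2_eq_square algebra_simps)
    finally have eq: "p' * q1 = k'\<^sup>2 + 1" .
    then have "p' * q1 > 0" by (smt (verit) zero_le_power2)
    then have "q1 > 0" using pq(1) by (simp add: zero_less_mult_iff)
    obtain a b c d where ih: "a * d - b * c = 1" "a\<^sup>2 + b\<^sup>2 = p'" "c\<^sup>2 + d\<^sup>2 = q1"
        "a * c + b * d = k'"
      using less.hyps [OF dec pq(1) \<open>q1 > 0\<close> eq] by blast
    have "a * (d + s * b) - b * (c + s * a) = 1"
      using ih(1) by (simp add: algebra_simps)
    moreover have "(c + s * a)\<^sup>2 + (d + s * b)\<^sup>2 = q'"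
    proof -
      have "(c + s * a)\<^sup>2 + (d + s * b)\<^sup>2 =
          (c\<^sup>2 + d\<^sup>2) + 2 * s * (a * c + b * d) + (s * s) * (a\<^sup>2 + b\<^sup>2)"
        by (simp add: power2_eq_square algebra_simps)
      also have "\<dots> = q1 + 2 * s * k' + p'" using ih s by simp
      also have "\<dots> = q' + 2 * p' - 2 * (s * s) * p'"
        by (simp add: q1_def k'_def algebra_simps)
      finally show ?thesis using s by simp
    qed
    moreover have "a * (c + s * a) + b * (d + s * b) = k"
    proof -
      have "a * (c + s * a) + b * (d + s * b) = (a * c + b * d) + s * (a\<^sup>2 + b\<^sup>2)"
        by (simp add: power2_eq_square algebra_simps)
      then show ?thesis using ih by (simp add: k'_def)
    qed
    ultimately show ?thesis using ih(2) by blast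
  qed
  consider "k = 0" | "p \<le> \<bar>k\<bar>" | "q \<le> \<bar>k\<bar>" | "k \<noteq> 0" "p \<ge> \<bar>k\<bar> + 1" "q \<ge> \<bar>k\<bar> + 1"
    by linarith
  then show ?case
  proof cases
    case 1
    then have "p = 1" "q = 1"
      using less.prems by (auto simp: zmult_eq_1_iff)
    then show ?thesis
      using 1 by (intro exI [of _ 1] exI [of _ 0]) auto
  next
    case 2
    then show ?thesis using step less.prems by blast
  next
    case 3
    then obtain a b c d where m: "a * d - b * c = 1" "a\<^sup>2 + b\<^sup>2 = q" "c\<^sup>2 + d\<^sup>2 = p"
        "a * c + b * d = k"
      using step [of q p] less.prems by (auto simp: mult.commute)
    \<comment> \<open>Exchanging the columns as well as the rows keeps the determinant equal to 1.\<close>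
    show ?thesis
      by (intro exI [of _ d] exI [of _ c] exI [of _ b] exI [of _ a])
         (use m in \<open>simp add: algebra_simps\<close>)
  next
    case 4
    have "(\<bar>k\<bar> + 1) * (\<bar>k\<bar> + 1) \<le> p * q"
      using 4 by (intro mult_mono) auto
    moreover have "(\<bar>k\<bar> + 1) * (\<bar>k\<bar> + 1) = k\<^sup>2 + 2 * \<bar>k\<bar> + 1"
      by (simp add: power2_eq_square algebra_simps)
    ultimately show ?thesis using less.prems 4 by linarith
  qed
qed

section \<open>Angles and norms\<close>

lemma Gamma_norm_eq: "Gamma_norm n = {{A, - A} | A. det A = 1 \<and> mat_normsq A = int n}"
  unfolding Gamma_norm_def PSL2Z_coset by (auto simp: PSL2Z_normsq)

text \<open>
  Infinite sets have cardinality 0, so finiteness is what turns the positive cardinality in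
  \<open>norm_set\<close> into non-emptiness.
\<close>

lemma finite_Gamma_norm: "finite (Gamma_norm n)"
proof -
  define I where "I = {- int n..int n}"
  define M :: "int \<times> int \<times> int \<times> int \<Rightarrow> int^2^2" where
    "M = (\<lambda>(a, b, c, d). vector [vector [a, b], vector [c, d]])"
  have bound: "x \<in> I" if "x\<^sup>2 \<le> int n" for x :: int
  proof -
    have "\<bar>x\<bar> \<le> x\<^sup>2"
    proof (cases "x = 0")
      case False
      then have "\<bar>x\<bar> * 1 \<le> \<bar>x\<bar> * \<bar>x\<bar>" by (intro mult_left_mono) auto
      then show ?thesis by (simp add: power2_eq_square)
    qed simp
    then show ?thesis using that by (auto simp: I_def)
  qed
  have "Gamma_norm n \<subseteq> (\<lambda>t. {M t, - M t}) ` (I \<times> I \<times> I \<times> I)"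
  proof
    fix \<gamma> assume "\<gamma> \<in> Gamma_norm n"
    then obtain A where A: "\<gamma> = {A, - A}" "mat_normsq A = int n"
      by (auto simp: Gamma_norm_eq)
    have "(A$1$1)\<^sup>2 \<le> int n" "(A$1$2)\<^sup>2 \<le> int n" "(A$2$1)\<^sup>2 \<le> int n" "(A$2$2)\<^sup>2 \<le> int n"
      unfolding A(2) [symmetric] mat_normsq_def by simp_all
    then have "(A$1$1, A$1$2, A$2$1, A$2$2) \<in> I \<times> I \<times> I \<times> I"
      using bound by simp
    moreover have "A = M (A$1$1, A$1$2, A$2$1, A$2$2)"
      by (simp add: M_def vec_eq_iff forall_2)
    ultimately show "\<gamma> \<in> (\<lambda>t. {M t, - M t}) ` (I \<times> I \<times> I \<times> I)"
      using A(1) by (intro image_eqI) auto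
  qed
  then show ?thesis
    by (rule finite_subset) (auto simp: I_def)
qed

text \<open>
  The equation forces \<open>y\<close> to have the parity of \<open>n\<close>, so \<open>p = (n + y) / 2\<close> and \<open>q = (n - y) / 2\<close>
  are integers, and \<open>p q = (n\<^sup>2 - y\<^sup>2) / 4 = (x / 2)\<^sup>2 + 1\<close>.
\<close>

lemma exists_matrix_of_two_squares:
  fixes x y :: int
  assumes "even x" and eq: "x\<^sup>2 + y\<^sup>2 = (int n)\<^sup>2 - 4"
  obtains A where "det A = 1" "mat_normsq A = int n"
    "2 * (A$1$1 * A$2$1 + A$1$2 * A$2$2) = x"
    "(A$1$1)\<^sup>2 + (A$1$2)\<^sup>2 - (A$2$1)\<^sup>2 - (A$2$2)\<^sup>2 = y"
proof -
  obtain k where k: "x = 2 * k" using \<open>even x\<close> by blast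
  have "even ((int n)\<^sup>2 - y\<^sup>2)"
  proof
    show "(int n)\<^sup>2 - y\<^sup>2 = 2 * (2 * k\<^sup>2 + 2)"
      using eq by (simp add: k power2_eq_square)
  qed
  then have "even (int n + y)" by simp
  then obtain p where p: "int n + y = 2 * p" by blast
  define q where "q = int n - p"
  have n: "int n = p + q" and y: "y = p - q"
    using p by (auto simp: q_def)
  have pq: "p * q = k\<^sup>2 + 1"
    using eq by (simp add: n y k power2_eq_square algebra_simps)
  \<comment> \<open>The product is positive, so \<open>p\<close> and \<open>q\<close> have the same sign, that of \<open>n\<close>.\<close>
  have "p * q > 0" using pq by (smt (verit) zero_le_power2)
  moreover have "p + q \<ge> 0" using n by linarith
  ultimately have "p > 0" "q > 0"
    by (auto simp: zero_less_mult_iff)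
  then obtain a b c d where m: "a * d - b * c = 1" "a\<^sup>2 + b\<^sup>2 = p" "c\<^sup>2 + d\<^sup>2 = q"
      "a * c + b * d = k"
    using gram_matrix_det_one pq by blast
  define A :: "int^2^2" where "A = vector [vector [a, b], vector [c, d]]"
  show ?thesis
  proof
    show "det A = 1" using m by (simp add: A_def det_2)
    show "mat_normsq A = int n" using m n by (simp add: A_def mat_normsq_def)
    show "2 * (A$1$1 * A$2$1 + A$1$2 * A$2$2) = x" using m k by (simp add: A_def)
    show "(A$1$1)\<^sup>2 + (A$1$2)\<^sup>2 - (A$2$1)\<^sup>2 - (A$2$2)\<^sup>2 = y" using m y by (simp add: A_def)
  qed
qed

text \<open>
  With \<open>u\<close>, \<open>v\<close> the rows of \<open>A\<close>, this is Lagrange's identity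
  \<open>(u \<bullet> v)\<^sup>2 + (det A)\<^sup>2 = |u|\<^sup>2 |v|\<^sup>2\<close> together with
  \<open>(|u|\<^sup>2 - |v|\<^sup>2)\<^sup>2 + 4 |u|\<^sup>2 |v|\<^sup>2 = (|u|\<^sup>2 + |v|\<^sup>2)\<^sup>2\<close>.
\<close>

lemma two_squares_of_matrix:
  assumes "det A = 1"
  shows "(2 * (A$1$1 * A$2$1 + A$1$2 * A$2$2))\<^sup>2 +
    ((A$1$1)\<^sup>2 + (A$1$2)\<^sup>2 - (A$2$1)\<^sup>2 - (A$2$2)\<^sup>2)\<^sup>2 = (mat_normsq A)\<^sup>2 - 4"
proof -
  have "(2 * (A$1$1 * A$2$1 + A$1$2 * A$2$2))\<^sup>2 +
      ((A$1$1)\<^sup>2 + (A$1$2)\<^sup>2 - (A$2$1)\<^sup>2 - (A$2$2)\<^sup>2)\<^sup>2 + 4 * (det A)\<^sup>2 = (mat_normsq A)\<^sup>2"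
    by (simp add: mat_normsq_def det_2 power2_eq_square algebra_simps)
  then show ?thesis using assms by simp
qed

lemma theta_image:
  "theta ` Gamma_norm n =
    {Arg (of_int x + \<i> * of_int y) | x y :: int.
       [x = 0] (mod 2) \<and> x\<^sup>2 + y\<^sup>2 = (int n)\<^sup>2 - 4}" (is "_ = ?R")
proof
  show "theta ` Gamma_norm n \<subseteq> ?R"
  proof
    fix t assume "t \<in> theta ` Gamma_norm n"
    then obtain A where A: "det A = 1" "mat_normsq A = int n" "t = theta {A, - A}"
      by (auto simp: Gamma_norm_eq)
    have "[2 * (A$1$1 * A$2$1 + A$1$2 * A$2$2) = 0] (mod 2)"
      by (simp add: cong_0_iff)
    with two_squares_of_matrix [OF A(1)] show "t \<in> ?R"
      unfolding A(2,3) theta_coset [OF A(1)] by blast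
  qed
  show "?R \<subseteq> theta ` Gamma_norm n"
  proof clarify
    fix x y :: int
    assume "[x = 0] (mod 2)" and eq: "x\<^sup>2 + y\<^sup>2 = (int n)\<^sup>2 - 4"
    then have "even x" by (simp add: cong_0_iff)
    then obtain A where A: "det A = 1" "mat_normsq A = int n"
        "2 * (A$1$1 * A$2$1 + A$1$2 * A$2$2) = x"
        "(A$1$1)\<^sup>2 + (A$1$2)\<^sup>2 - (A$2$1)\<^sup>2 - (A$2$2)\<^sup>2 = y"
      using exists_matrix_of_two_squares eq by blast
    have "Arg (of_int x + \<i> * of_int y) = theta {A, - A}"
      by (simp only: theta_coset [OF A(1)] A(3,4))
    moreover have "{A, - A} \<in> Gamma_norm n"
      using A(1,2) by (auto simp: Gamma_norm_eq)
    ultimately show "Arg (of_int x + \<i> * of_int y) \<in> theta ` Gamma_norm n"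
      by (rule image_eqI)
  qed
qed

lemma even_summand_of_two_squares:
  fixes x y m :: int
  assumes "x\<^sup>2 + y\<^sup>2 = m\<^sup>2 - 4"
  shows "even x \<or> even y"
proof (rule ccontr)
  assume "\<not> (even x \<or> even y)"
  then obtain r s where "x = 2 * r + 1" "y = 2 * s + 1"
    by (auto elim!: oddE)
  then have m: "m\<^sup>2 = 4 * (r\<^sup>2 + r + s\<^sup>2 + s + 1) + 2"
    using assms by (simp add: power2_eq_square algebra_simps)
  then have "even (m\<^sup>2)" by simp
  then obtain t where "m = 2 * t" by auto
  with m have "4 * t\<^sup>2 = 4 * (r\<^sup>2 + r + s\<^sup>2 + s + 1) + 2"
    by (simp add: power2_eq_square)
  then show False by presburger
qed

lemma norm_set_eq: "norm_set = {n. (int n)\<^sup>2 - 4 \<in> sums_two_squares}"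
proof -
  have "card (Gamma_norm n) > 0 \<longleftrightarrow> (int n)\<^sup>2 - 4 \<in> sums_two_squares" for n
  proof -
    have "card (Gamma_norm n) > 0 \<longleftrightarrow> theta ` Gamma_norm n \<noteq> {}"
      by (simp add: card_gt_0_iff finite_Gamma_norm)
    also have "\<dots> \<longleftrightarrow> (\<exists>x y. even x \<and> x\<^sup>2 + y\<^sup>2 = (int n)\<^sup>2 - 4)"
      unfolding theta_image by (auto simp: cong_0_iff)
    also have "\<dots> \<longleftrightarrow> (\<exists>x y. x\<^sup>2 + y\<^sup>2 = (int n)\<^sup>2 - 4)"
      by (metis even_summand_of_two_squares add.commute)
    also have "\<dots> \<longleftrightarrow> (int n)\<^sup>2 - 4 \<in> sums_two_squares"
      unfolding sums_two_squares_def mem_Collect_eq by metis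
    finally show ?thesis .
  qed
  then show ?thesis by (simp add: norm_set_def)
qed

theorem proposition1p2:
  "norm_set = {n. (int n)\<^sup>2 - 4 \<in> sums_two_squares} \<and>
   (\<forall>n\<in>norm_set. theta ` Gamma_norm n =
      {Arg (of_int x + \<i> * of_int y) | x y :: int.
         [x = 0] (mod 2) \<and> x\<^sup>2 + y\<^sup>2 = (int n)\<^sup>2 - 4})"
  using norm_set_eq theta_image by blast

end
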